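(* Let $(A,\mu,\alpha)$ be a left Hom-alternative algebra over $\mathbf{K}$, and let $f:(M,\mu_M,\beta)\to(M',\mu_{M'},\beta')$ be a morphism of modules over $(A,\mu,\alpha)$. Set $\tilde\mu_M=\mu_M\circ(\alpha^2\otimes \mathrm{Id}_M)$ and $\tilde\mu_{M'}=\mu_{M'}\circ(\alpha^2\otimes \mathrm{Id}_{M'})$. Then $f:(M,\tilde\mu_M,\beta)\to(M',\tilde\mu_{M'},\beta')$ is a morphism of modules over the left Hom-alternative algebra $(A,\mu,\alpha)$.
   Context: $\mathbf{K}$ is a field of characteristic $0$; linearity and $\otimes$ are over $\mathbf{K}$. A left Hom-alternative algebra is a triple $(A,\mu,\alpha)$ where $A$ is a $\mathbf{K}$-linear space, $\mu:A\otimes A\to A$ is a multiplication and $\alpha:A\to A$ is a linear map such that $\mu(\alpha(x),\mu(x,y))=\mu(\mu(x,x),\alpha(y))$ for all $x,y\in A$. A module over $(A,\mu,\alpha)$ is a triple $(M,\mu_M,\beta)$ where $M$ is a $\mathbf{K}$-linear space, $\beta:M\to M$ is linear and $\mu_M:A\otimes M\to M$ is a $\mathbf{K}$-bilinear map satisfying $\mu_M(\alpha(x),\mu_M(x,m))=\mu_M(\mu(x,x),\beta(m))$ for all $x\in A$, $m\in M$. A morphism $f:(M,\mu_M,\beta)\to(M',\mu_{M'},\beta')$ of modules over $(A,\mu,\alpha)$ is a linear map $f:M\to M'$ between modules over $(A,\mu,\alpha)$ such that $f(\mu_M(x,m))=\mu_{M'}(x,f(m))$ for all $x\in A$, $m\in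 M$.
   Formalization: The formal statement additionally assumes that α is multiplicative, α(μ(x,y)) = μ(α(x),α(y)); without this the claim fails, e.g. for A = M = M' = ℝ with ordinary multiplication, α = β = β' = 2·Id and f = Id. *)

theory Defs
  imports Complex_Main
begin

text \<open>A linear map defined on a tensor product \<open>U \<otimes> V\<close> is given by the
  corresponding bilinear map, in curried form.\<close>

definition bilinear_map ::
  "('k::field \<Rightarrow> 'u::ab_group_add \<Rightarrow> 'u) \<Rightarrow> ('k \<Rightarrow> 'v::ab_group_add \<Rightarrow> 'v) \<Rightarrow>
   ('k \<Rightarrow> 'w::ab_group_add \<Rightarrow> 'w) \<Rightarrow> ('u \<Rightarrow> 'v \<Rightarrow> 'w) \<Rightarrow> bool"
where
  "bilinear_map sU sV sW b \<longleftrightarrow>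
     (\<forall>v. Vector_Spaces.linear sU sW (\<lambda>u. b u v)) \<and>
     (\<forall>u. Vector_Spaces.linear sV sW (\<lambda>v. b u v))"

text \<open>As in the source, \<open>\<alpha>\<close> is only required to be linear here; it need not be an algebra
  endomorphism.\<close>

locale left_hom_alternative_algebra = A: vector_space sA
  for sA :: "'k::field_char_0 \<Rightarrow> 'a::ab_group_add \<Rightarrow> 'a" +
  fixes \<mu> :: "'a \<Rightarrow> 'a \<Rightarrow> 'a"
    and \<alpha> :: "'a \<Rightarrow> 'a"
  assumes mult_bilinear: "bilinear_map sA sA sA \<mu>"
    and twist_linear: "Vector_Spaces.linear sA sA \<alpha>"
    and left_hom_alternative: "\<mu> (\<alpha> x) (\<mu> x y) = \<mu> (\<mu> x x) (\<alpha> y)"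

locale left_hom_alternative_module =
  left_hom_alternative_algebra sA \<mu> \<alpha> + M: vector_space sM
  for sA :: "'k::field_char_0 \<Rightarrow> 'a::ab_group_add \<Rightarrow> 'a"
    and \<mu> :: "'a \<Rightarrow> 'a \<Rightarrow> 'a"
    and \<alpha> :: "'a \<Rightarrow> 'a"
    and sM :: "'k \<Rightarrow> 'm::ab_group_add \<Rightarrow> 'm" +
  fixes \<mu>M :: "'a \<Rightarrow> 'm \<Rightarrow> 'm"
    and \<beta> :: "'m \<Rightarrow> 'm"
  assumes action_bilinear: "bilinear_map sA sM sM \<mu>M"
    and module_twist_linear: "Vector_Spaces.linear sM sM \<beta>"
    and module_axiom: "\<mu>M (\<alpha> x) (\<mu>M x m) = \<mu>M (\<mu> x x) (\<beta> m)"

text \<open>A morphism is a map between modules, so both triples are required to be modules.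
  Compatibility of \<open>f\<close> with the twisting maps \<open>\<beta>\<close>, \<open>\<beta>'\<close> is not part of the notion.\<close>

locale left_hom_alternative_module_morphism =
  source: left_hom_alternative_module sA \<mu> \<alpha> sM \<mu>M \<beta> +
  target: left_hom_alternative_module sA \<mu> \<alpha> sM' \<mu>M' \<beta>'
  for sA :: "'k::field_char_0 \<Rightarrow> 'a::ab_group_add \<Rightarrow> 'a"
    and \<mu> :: "'a \<Rightarrow> 'a \<Rightarrow> 'a"
    and \<alpha> :: "'a \<Rightarrow> 'a"
    and sM :: "'k \<Rightarrow> 'm::ab_group_add \<Rightarrow> 'm"
    and \<mu>M :: "'a \<Rightarrow> 'm \<Rightarrow> 'm"
    and \<beta> :: "'m \<Rightarrow> 'm"
    and sM' :: "'k \<Rightarrow> 'n::ab_group_add \<Rightarrow> 'n"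
    and \<mu>M' :: "'a \<Rightarrow> 'n \<Rightarrow> 'n"
    and \<beta>' :: "'n \<Rightarrow> 'n" +
  fixes f :: "'m \<Rightarrow> 'n"
  assumes morphism_linear: "Vector_Spaces.linear sM sM' f"
    and morphism_action: "f (\<mu>M x m) = \<mu>M' x (f m)"

text \<open>The map \<open>\<mu>\<^sub>M \<circ> (\<alpha>\<^sup>2 \<otimes> Id\<^sub>M)\<close>, where \<open>\<alpha>\<^sup>2 = \<alpha> \<circ> \<alpha>\<close>.\<close>

definition twisted_action :: "('a \<Rightarrow> 'a) \<Rightarrow> ('a \<Rightarrow> 'm \<Rightarrow> 'm) \<Rightarrow> 'a \<Rightarrow> 'm \<Rightarrow> 'm"
where
  "twisted_action \<alpha> \<mu>M = (\<lambda>x m. \<mu>M ((\<alpha> ^^ 2) x) m)"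

end

theory Submission
  imports Defs
begin

text \<open>The twisted action lets x act as \<alpha>(\<alpha>(x)) acts originally. Since
  \<open>f\<close> commutes with the action of every element of the algebra, it commutes in
  particular with that of \<alpha>(\<alpha>(x)), whatever \<alpha> is. The substance is that both
  twisted triples are again modules, which is \<open>twisted_action_module\<close>. There the
  original module axiom is used at \<alpha>(\<alpha>(x)), and \<alpha> must respect squares. The
  algebra locale makes \<alpha> only linear, so multiplicativity of \<alpha> enters as the separate
  hypothesis \<open>multiplicative\<close>.\<close>

lemma twisted_action_apply: "twisted_action \<alpha> \<mu>M x m = \<mu>M (\<alpha> (\<alpha> x)) m"
  by (simp add: twisted_action_def numeral_2_eq_2)

lemma bilinear_map_compose_left:
  assumes "bilinear_map sU sV sW b" and "Vector_Spaces.linear sT sU g"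
  shows "bilinear_map sT sV sW (\<lambda>t v. b (g t) v)"
  unfolding bilinear_map_def
proof (intro conjI allI)
  show "Vector_Spaces.linear sT sW (\<lambda>t. b (g t) v)" for v
    using Vector_Spaces.linear_compose[of sT sU g sW "\<lambda>u. b u v"] assms
    by (simp add: bilinear_map_def o_def)
  show "Vector_Spaces.linear sV sW (\<lambda>v. b (g t) v)" for t
    using assms(1) by (simp add: bilinear_map_def)
qed

lemma (in left_hom_alternative_module) twisted_action_module:
  assumes multiplicative: "\<And>x y. \<alpha> (\<mu> x y) = \<mu> (\<alpha> x) (\<alpha> y)"
  shows "left_hom_alternative_module sA \<mu> \<alpha> sM (twisted_action \<alpha> \<mu>M) \<beta>"
proof (intro left_hom_alternative_module.intro left_hom_alternative_module_axioms.intro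
    left_hom_alternative_algebra_axioms M.vector_space_axioms)
  \<comment> \<open>Precomposition in the first argument is applied twice, once for each factor of
    \<alpha>.\<close>
  have "bilinear_map sA sM sM (\<lambda>x m. \<mu>M (\<alpha> (\<alpha> x)) m)"
    by (intro bilinear_map_compose_left[OF _ twist_linear]
        bilinear_map_compose_left[OF action_bilinear twist_linear])
  then show "bilinear_map sA sM sM (twisted_action \<alpha> \<mu>M)"
    by (simp add: twisted_action_apply[abs_def])
  show "Vector_Spaces.linear sM sM \<beta>"
    by (rule module_twist_linear)
  \<comment> \<open>With z = \<alpha>(\<alpha>(x)), the left side is
    \<open>\<mu>M (\<alpha> z) (\<mu>M z m)\<close>, which the module axiom turns into
    \<open>\<mu>M (\<mu> z z) (\<beta> m)\<close>. Multiplicativity, used twice, gives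
    \<open>\<mu> z z = \<alpha> (\<alpha> (\<mu> x x))\<close>, hence the right side.\<close>
  show "twisted_action \<alpha> \<mu>M (\<alpha> x) (twisted_action \<alpha> \<mu>M x m)
      = twisted_action \<alpha> \<mu>M (\<mu> x x) (\<beta> m)" for x m
    by (simp add: twisted_action_apply multiplicative module_axiom)
qed

theorem theorem3p2:
  fixes sA :: "'k::field_char_0 \<Rightarrow> 'a::ab_group_add \<Rightarrow> 'a"
    and \<mu> :: "'a \<Rightarrow> 'a \<Rightarrow> 'a"
    and \<alpha> :: "'a \<Rightarrow> 'a"
    and sM :: "'k \<Rightarrow> 'm::ab_group_add \<Rightarrow> 'm"
    and \<mu>M :: "'a \<Rightarrow> 'm \<Rightarrow> 'm"
    and \<beta> :: "'m \<Rightarrow> 'm"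
    and sM' :: "'k \<Rightarrow> 'n::ab_group_add \<Rightarrow> 'n"
    and \<mu>M' :: "'a \<Rightarrow> 'n \<Rightarrow> 'n"
    and \<beta>' :: "'n \<Rightarrow> 'n"
    and f :: "'m \<Rightarrow> 'n"
  assumes algebra: "left_hom_alternative_algebra sA \<mu> \<alpha>"
    and multiplicative: "\<And>x y. \<alpha> (\<mu> x y) = \<mu> (\<alpha> x) (\<alpha> y)"
    and morphism: "left_hom_alternative_module_morphism sA \<mu> \<alpha> sM \<mu>M \<beta> sM' \<mu>M' \<beta>' f"
  shows "left_hom_alternative_module_morphism sA \<mu> \<alpha>
           sM (twisted_action \<alpha> \<mu>M) \<beta> sM' (twisted_action \<alpha> \<mu>M') \<beta>' f"
proof -
  interpret left_hom_alternative_module_morphism sA \<mu> \<alpha> sM \<mu>M \<beta> sM' \<mu>M' \<beta>' f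
    by (rule morphism)
  \<comment> \<open>After both module structures and linearity of \<open>f\<close>, only
    equivariance is left for the simplifier: \<open>morphism_action\<close> at
    \<alpha>(\<alpha>(x)).\<close>
  show ?thesis
    by (intro left_hom_alternative_module_morphism.intro
        left_hom_alternative_module_morphism_axioms.intro
        source.twisted_action_module target.twisted_action_module
        multiplicative morphism_linear)
      (simp add: twisted_action_apply morphism_action)
qed

end
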